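(* Let $\mathbb{F}_q$ be a finite field with $q=p^k$ elements, where $p\equiv 1\pmod 3$ is prime, and let $a_1,a_2,a_3\in\mathbb{F}_q^{\ast}$. Let $M_k(a_1,a_2,a_3)$ denote the number of $(x_1,x_2,x_3)\in\mathbb{F}_q^3$ with $a_1x_1^3+a_2x_2^3+a_3x_3^3=0$. Then $$M_k(a_1,a_2,a_3)=\begin{cases} q^2+c(q-1), & \text{if } a_1a_2a_3 \text{ is cubic},\\ q^2+\frac{1}{2}(q-1)(9d-c), & \text{if } a_1a_2a_3 \text{ is non-cubic},\end{cases}$$ where $c,d$ are the integers uniquely determined by $$4q=c^2+27d^2,\quad c\equiv 1\pmod 3,\quad (c,p)=1,\quad 9d\equiv c\left(2(a_1a_2a_3)^{\frac{q-1}{3}}+1\right)\pmod p,$$ with $(a_1a_2a_3)^{(q-1)/3}\in\mathbb{F}_p$ identified with an integer residue mod $p$.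
   Context: An element $z\in\mathbb{F}_q^{\ast}$ is called cubic if $z=y^3$ for some $y\in\mathbb{F}_q^{\ast}$, and non-cubic otherwise.
   Formalization: When a1a2a3 is cubic, the congruence 9d ≡ c(2(a1a2a3)^((q-1)/3)+1) (mod p) contradicts the other three conditions (it forces p | c), so it is imposed only in the non-cubic case; in the cubic case c is unique and d is determined only up to sign. *)

theory Defs
  imports Complex_Main "HOL-Library.Cardinality" "HOL-Number_Theory.Cong" "HOL-Computational_Algebra.Primes"
begin

definition is_cubic :: "'a::field \<Rightarrow> bool" where
  "is_cubic z \<longleftrightarrow> (\<exists>y. y \<noteq> 0 \<and> z = y ^ 3)"

definition cubic_zeros :: "'a::field \<Rightarrow> 'a \<Rightarrow> 'a \<Rightarrow> ('a \<times> 'a \<times> 'a) set" where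
  "cubic_zeros a1 a2 a3 = {(x1, x2, x3). a1 * x1 ^ 3 + a2 * x2 ^ 3 + a3 * x3 ^ 3 = 0}"

definition norm_rep :: "nat \<Rightarrow> nat \<Rightarrow> int \<Rightarrow> int \<Rightarrow> bool" where
  "norm_rep p q c d \<longleftrightarrow>
     4 * int q = c\<^sup>2 + 27 * d\<^sup>2 \<and> [c = 1] (mod 3) \<and> coprime c (int p)"

text \<open>The congruence \<open>9 d \<equiv> c (2 A\<^bsup>(q-1)/3\<^esup> + 1) (mod p)\<close>: the power of \<open>A\<close> lies in the
  prime field, and \<open>t\<close> is an integer representing it (unique modulo \<open>p\<close> when the field
  has characteristic \<open>p\<close>). Such \<open>d\<close> exist alongside \<^const>\<open>norm_rep\<close> only for non-cubic \<open>A\<close>: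
  if the power is 1, the congruence reads \<open>9 d \<equiv> 3 c\<close>, whence \<open>4 q = c\<^sup>2 + 27 d\<^sup>2 \<equiv> 4 c\<^sup>2\<close>
  and \<open>p\<close> divides \<open>c\<close>.\<close>

definition sign_cong :: "nat \<Rightarrow> nat \<Rightarrow> 'a::field \<Rightarrow> int \<Rightarrow> int \<Rightarrow> bool" where
  "sign_cong p q A c d \<longleftrightarrow>
     (\<exists>t::int. of_int t = A ^ ((q - 1) div 3) \<and> [9 * d = c * (2 * t + 1)] (mod int p))"

end

theory Submission
  imports Defs "HOL-Computational_Algebra.Polynomial"
begin

text \<open>
  Put \<open>m = (q - 1) / 3\<close> and let \<open>w\<close> be a primitive cube root of unity of the field. The cubic character
  \<open>\<chi>\<close> sends \<open>x \<noteq> 0\<close> to the complex cube root of unity corresponding to \<open>x\<^bsup>m\<^esup> \<in> {1, w, w\<^sup>2}\<close>. The number of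
  cube roots of \<open>u\<close> is \<open>1 + \<chi>(u) + \<chi>\<^bsup>-1\<^esup>(u)\<close>, so \<open>M\<close> is \<open>q\<^sup>2\<close> plus a combination of sums of products of three
  characters over \<open>u\<^sub>1 + u\<^sub>2 + u\<^sub>3 = 0\<close>. By homogeneity only those with trivial product survive, which gives
  \<open>M = q\<^sup>2 + (q - 1) 2 Re (\<chi>\<^bsup>-1\<^esup>(a\<^sub>1 a\<^sub>2 a\<^sub>3) J)\<close> with the Jacobi sum \<open>J = \<Sum>\<^sub>x \<chi>(x) \<chi>(1 - x)\<close>.

  Write \<open>J = n\<^sub>0 + n\<^sub>1 \<omega> + n\<^sub>2 \<omega>\<^sup>2 = c / 2 + (3 \<surd>3 / 2) d \<i>\<close>, where \<open>n\<^sub>i\<close> counts the \<open>x\<close> with \<open>(x (1 - x))\<^bsup>m\<^esup> = w\<^bsup>i\<^esup>\<close>.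
  Then \<open>|J|\<^sup>2 = q\<close> is the norm equation; an order 3 symmetry of \<open>x (1 - x)\<close> gives the congruences modulo 3,
  hence the integrality of \<open>d\<close>; and power sums in the field show that \<open>J\<close> reduces to 0 under \<open>\<omega> \<mapsto> w\<close>, which
  is the congruence between \<open>c\<close> and \<open>d\<close>, while its conjugate reduces to \<open>\<plusminus> binomial (2 m, m) \<noteq> 0\<close>, so \<open>p\<close>
  does not divide \<open>c\<close>. In the non-cubic case one takes \<open>w = (a\<^sub>1 a\<^sub>2 a\<^sub>3)\<^bsup>m\<^esup>\<close>.
\<close>

section \<open>Representations of prime powers by norm forms\<close>

lemma prime_not_dvd_norm_form_snd:
  fixes p n c d :: int
  assumes "prime p" "p dvd c\<^sup>2 + n * d\<^sup>2" "\<not> p dvd c"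
  shows "\<not> p dvd d"
proof
  assume "p dvd d"
  then have "p dvd (c\<^sup>2 + n * d\<^sup>2) - n * d\<^sup>2"
    using assms(2) by (intro dvd_diff) (simp_all add: power2_eq_square)
  then show False
    using assms(1,3) prime_dvd_power[of p c 2] by simp
qed

lemma prime_power_dvd_mult:
  fixes p x y :: int
  assumes "prime p" "p ^ k dvd x * y" "\<not> p dvd x \<or> \<not> p dvd y"
  shows "p ^ k dvd x \<or> p ^ k dvd y"
proof -
  have "coprime (p ^ k) x \<or> coprime (p ^ k) y"
    using assms(1,3) by (auto intro: prime_imp_coprime)
  then show ?thesis
    using assms(2) coprime_dvd_mult_left_iff coprime_dvd_mult_right_iff by blast
qed

lemma norm_form_snd_eq_0_if_dvd:
  fixes Q M n x y :: int
  assumes "Q > 0" "n > M\<^sup>2" "x\<^sup>2 + n * y\<^sup>2 = (M * Q)\<^sup>2" "Q dvd y"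
  shows "y = 0"
proof (rule ccontr)
  assume "y \<noteq> 0"
  then have "\<bar>Q\<bar> \<le> \<bar>y\<bar>"
    using \<open>Q dvd y\<close> by (rule dvd_imp_le_int)
  then have "Q\<^sup>2 \<le> y\<^sup>2"
    by (simp only: abs_le_square_iff)
  then have "M\<^sup>2 * Q\<^sup>2 < n * y\<^sup>2"
    using assms(1,2) by (intro mult_less_le_imp_less) simp_all
  also have "\<dots> \<le> x\<^sup>2 + n * y\<^sup>2"
    by simp
  also have "\<dots> = M\<^sup>2 * Q\<^sup>2"
    using assms(3) by (simp add: power_mult_distrib)
  finally show False
    by simp
qed

text \<open>With \<open>Q = p\<^bsup>k\<^esup>\<close>, the product of \<open>c d' - c' d\<close> and \<open>c d' + c' d\<close> is a multiple of \<open>Q\<close>, and the composition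
  identity \<open>(c c' \<plusminus> n d d')\<^sup>2 + n (c d' \<mp> c' d)\<^sup>2 = (M Q)\<^sup>2\<close> forces a factor divisible by \<open>Q\<close> to
  vanish, because \<open>n > M\<^sup>2\<close>.\<close>
lemma prime_power_norm_form_unique:
  fixes p M n c d c' d' :: int
  assumes "prime p" "odd p" "k > 0" "n > M\<^sup>2" "M > 0"
    and rep: "M * p ^ k = c\<^sup>2 + n * d\<^sup>2" "\<not> p dvd c"
    and rep': "M * p ^ k = c'\<^sup>2 + n * d'\<^sup>2" "\<not> p dvd c'"
  shows "\<bar>c'\<bar> = \<bar>c\<bar> \<and> \<bar>d'\<bar> = \<bar>d\<bar>"
proof -
  define Q where "Q = p ^ k"
  define x where "x = c * d' - c' * d"
  define y where "y = c * d' + c' * d"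
  have norm: "M * Q = c\<^sup>2 + n * d\<^sup>2" "M * Q = c'\<^sup>2 + n * d'\<^sup>2"
    using rep rep' by (simp_all add: Q_def)
  have Q_pos: "Q > 0" and "p dvd Q"
    using prime_gt_0_int[OF \<open>prime p\<close>] \<open>k > 0\<close> by (auto simp: Q_def)
  have x_mult_y: "x * y = M * Q * (d'\<^sup>2 - d\<^sup>2)"
  proof -
    have "x * y = (c\<^sup>2 + n * d\<^sup>2) * d'\<^sup>2 - (c'\<^sup>2 + n * d'\<^sup>2) * d\<^sup>2"
      by (simp add: x_def y_def algebra_simps power2_eq_square)
    then show ?thesis
      by (simp add: right_diff_distrib flip: norm)
  qed
  have "p dvd c'\<^sup>2 + n * d'\<^sup>2"
    using \<open>p dvd Q\<close> unfolding norm(2)[symmetric] by (rule dvd_mult)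
  then have "\<not> p dvd d'"
    using prime_not_dvd_norm_form_snd \<open>prime p\<close> rep'(2) by blast
  moreover have "\<not> p dvd 2"
    using \<open>prime p\<close> \<open>odd p\<close> primes_dvd_imp_eq[of p 2] by auto
  ultimately have "\<not> p dvd x + y"
    using \<open>prime p\<close> rep(2) by (simp add: x_def y_def prime_dvd_mult_iff)
  then have "\<not> p dvd x \<or> \<not> p dvd y"
    by auto
  moreover have "p ^ k dvd x * y"
    unfolding x_mult_y Q_def by simp
  ultimately have "Q dvd x \<or> Q dvd y"
    unfolding Q_def by (intro prime_power_dvd_mult \<open>prime p\<close>)
  moreover have "(c * c' + n * d * d')\<^sup>2 + n * x\<^sup>2 = (M * Q)\<^sup>2"
    and "(c * c' - n * d * d')\<^sup>2 + n * y\<^sup>2 = (M * Q)\<^sup>2"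
    using norm unfolding x_def y_def by algebra+
  ultimately have "x * y = 0"
    using norm_form_snd_eq_0_if_dvd[OF Q_pos \<open>n > M\<^sup>2\<close>] by auto
  then have "d'\<^sup>2 = d\<^sup>2"
    using x_mult_y Q_pos \<open>M > 0\<close> by simp
  moreover from this have "c'\<^sup>2 = c\<^sup>2"
    using norm by simp
  ultimately show ?thesis
    by (simp add: abs_eq_iff power2_eq_iff)
qed

lemma norm_rep_unique:
  assumes "prime p" "odd p" "k > 0" and rep: "norm_rep p (p ^ k) c d" "norm_rep p (p ^ k) c' d'"
  shows "c' = c" "\<bar>d'\<bar> = \<bar>d\<bar>"
proof -
  have "\<not> int p dvd c" if "norm_rep p (p ^ k) c d" for c d
    using that \<open>prime p\<close> prime_gt_1_nat[of p]
    by (auto simp: norm_rep_def coprime_commute dest: coprime_absorb_left)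
  then have "\<not> int p dvd c" "\<not> int p dvd c'"
    using rep by blast+
  then have abs_eq: "\<bar>c'\<bar> = \<bar>c\<bar> \<and> \<bar>d'\<bar> = \<bar>d\<bar>"
    using rep assms(1-3) by (intro prime_power_norm_form_unique[of "int p" k 4 27]) (auto simp: norm_rep_def)
  have "c mod 3 = 1" "c' mod 3 = 1"
    using rep by (simp_all add: norm_rep_def cong_def)
  then have "c' \<noteq> - c"
    by presburger
  then show "c' = c"
    using abs_eq by (simp add: abs_eq_iff)
  show "\<bar>d'\<bar> = \<bar>d\<bar>"
    using abs_eq by simp
qed

section \<open>Fixed points of maps of prime order\<close>

lemma card_orbit_prime:
  assumes "prime p" "(f ^^ p) x = x" "f x \<noteq> x"
  shows "card (range (\<lambda>i. (f ^^ i) x)) = p"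
proof -
  have "(f ^^ i) x \<noteq> x" if "0 < i" "i < p" for i
  proof
    assume "(f ^^ i) x = x"
    then have fix_mult: "(f ^^ (i * j)) x = x" for j
      by (induction j) (simp_all add: funpow_add)
    have "coprime i p"
      using that \<open>prime p\<close> by (metis coprime_commute nat_dvd_not_less prime_imp_coprime)
    then obtain j where "[i * j = 1] (mod p)"
      using cong_solve_coprime_nat by auto
    then have "(i * j) mod p = 1"
      using prime_gt_1_nat[OF \<open>prime p\<close>] by (simp add: cong_def)
    then have "(f ^^ (i * j)) x = f x"
      using funpow_mod_eq[OF assms(2), of "i * j"] by simp
    then show False
      using fix_mult \<open>f x \<noteq> x\<close> by simp
  qed
  with assms(2) have "inj_on (\<lambda>i. (f ^^ i) x) {0..<p}"
    by (rule inj_on_funpow_least)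
  moreover have "range (\<lambda>i. (f ^^ i) x) = (\<lambda>i. (f ^^ i) x) ` {0..<p}"
  proof -
    have "(f ^^ i) x = (f ^^ (i mod p)) x" and "i mod p \<in> {0..<p}" for i
      using funpow_mod_eq[OF assms(2)] prime_gt_0_nat[OF \<open>prime p\<close>] by simp_all
    then show ?thesis
      by blast
  qed
  ultimately show ?thesis
    by (simp add: card_image)
qed

lemma equiv_iterates:
  assumes "n > 0" and closed: "\<And>x. x \<in> A \<Longrightarrow> f x \<in> A" and order: "\<And>x. x \<in> A \<Longrightarrow> (f ^^ n) x = x"
  shows "equiv A {(x, y). x \<in> A \<and> y \<in> range (\<lambda>i. (f ^^ i) x)}" (is "equiv A ?R")
proof (rule equivI)
  have iterate: "(f ^^ i) x \<in> A" if "x \<in> A" for i x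
    using that closed by (induction i) simp_all
  have add: "(f ^^ i) ((f ^^ j) x) = (f ^^ (i + j)) x" for i j x
    by (simp add: funpow_add)
  show "?R \<subseteq> A \<times> A"
    using iterate by auto
  show "refl_on A ?R"
    by (rule refl_onI) (auto intro: range_eqI[of _ _ 0])
  show "sym ?R"
  proof (rule symI)
    fix x y assume "(x, y) \<in> ?R"
    then obtain i where "x \<in> A" and y: "y = (f ^^ i) x"
      by auto
    have "i mod n \<le> n"
      using \<open>n > 0\<close> by (simp add: less_imp_le)
    moreover have "y = (f ^^ (i mod n)) x"
      using y funpow_mod_eq[OF order[OF \<open>x \<in> A\<close>]] by simp
    ultimately have "(f ^^ (n - i mod n)) y = x"
      using order[OF \<open>x \<in> A\<close>] by (simp add: add)
    then have "x \<in> range (\<lambda>i. (f ^^ i) y)"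
      by (metis rangeI)
    then show "(y, x) \<in> ?R"
      using iterate[OF \<open>x \<in> A\<close>] y by simp
  qed
  show "trans ?R"
    by (rule transI) (auto simp: add)
qed

lemma prime_dvd_card_if_no_fixed_points:
  assumes "prime p" "finite A"
    and closed: "\<And>x. x \<in> A \<Longrightarrow> f x \<in> A" and order: "\<And>x. x \<in> A \<Longrightarrow> (f ^^ p) x = x"
    and no_fixed: "\<And>x. x \<in> A \<Longrightarrow> f x \<noteq> x"
  shows "p dvd card A"
proof -
  define R where "R = {(x, y). x \<in> A \<and> y \<in> range (\<lambda>i. (f ^^ i) x)}"
  have "equiv A R"
    unfolding R_def using prime_gt_0_nat[OF \<open>prime p\<close>] closed order by (rule equiv_iterates)
  moreover have "p dvd card X" if quotient: "X \<in> A // R" for X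
  proof -
    obtain x where "x \<in> A" "X = R `` {x}"
      using quotient by (rule quotientE)
    then have "X = range (\<lambda>i. (f ^^ i) x)"
      by (auto simp: R_def)
    then show ?thesis
      using \<open>x \<in> A\<close> card_orbit_prime[OF \<open>prime p\<close> order no_fixed] by simp
  qed
  ultimately show ?thesis
    using \<open>finite A\<close> by (rule equiv_imp_dvd_card[rotated])
qed

lemma card_cong_card_fixed_points:
  assumes "prime p" "finite A"
    and closed: "\<And>x. x \<in> A \<Longrightarrow> f x \<in> A" and order: "\<And>x. x \<in> A \<Longrightarrow> (f ^^ p) x = x"
  shows "[card A = card {x \<in> A. f x = x}] (mod p)"
proof -
  have "f (f x) \<noteq> f x" if "x \<in> A" "f x \<noteq> x" for x
  proof
    assume "f (f x) = f x"
    then have "(f ^^ i) (f x) = f x" for i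
      by (induction i) simp_all
    then have "(f ^^ Suc (p - 1)) x = f x"
      by (simp only: funpow_Suc_right o_apply)
    then show False
      using order that prime_gt_0_nat[OF \<open>prime p\<close>] by simp
  qed
  then have "p dvd card {x \<in> A. f x \<noteq> x}"
    using assms by (intro prime_dvd_card_if_no_fixed_points[where f = f]) auto
  moreover have "card A = card {x \<in> A. f x = x} + card {x \<in> A. f x \<noteq> x}"
    using \<open>finite A\<close> by (subst card_Un_disjoint[symmetric]) (auto intro: arg_cong[where f = card])
  ultimately show ?thesis
    by (simp add: cong_def mod_add_right_eq[symmetric] dvd_eq_mod_eq_0)
qed

section \<open>Power sums over a finite field\<close>

lemma card_field_gt_1: "CARD('a::{field,finite}) > 1"
proof -
  have "card {0 :: 'a, 1} \<le> CARD('a)"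
    by (rule card_mono) simp_all
  then show ?thesis
    by simp
qed

lemma of_nat_card_eq_0: "of_nat CARD('a::{ring_1,finite}) = (0::'a)"
proof -
  have "(\<Sum>x\<in>UNIV. x + 1) = (\<Sum>x\<in>UNIV. x :: 'a)"
    by (rule sum.reindex_bij_witness[of _ "\<lambda>x. x - 1" "\<lambda>x. x + 1"]) auto
  then show ?thesis
    by (simp add: sum.distrib)
qed

lemma CHAR_eq_if_card_prime_power:
  assumes "prime p" "CARD('a::{field,finite}) = p ^ k"
  shows "CHAR('a) = p"
proof -
  have "prime CHAR('a)"
    using prime_CHAR_semidom[where 'a = 'a] finite_imp_CHAR_pos[where 'a = 'a] by simp
  moreover have "CHAR('a) dvd p ^ k"
    using of_nat_card_eq_0[where 'a = 'a] unfolding of_nat_eq_0_iff_char_dvd assms(2) .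
  ultimately show ?thesis
    using \<open>prime p\<close> by (metis prime_dvd_power primes_dvd_imp_eq)
qed

lemma power_card_minus_1_eq_1:
  fixes x :: "'a::{field,finite}"
  assumes "x \<noteq> 0"
  shows "x ^ (CARD('a) - 1) = 1"
proof -
  have "(\<Prod>y\<in>UNIV - {0}. x * y) = (\<Prod>y\<in>UNIV - {0}. y)"
    by (rule prod.reindex_bij_witness[of _ "\<lambda>y. y / x" "\<lambda>y. x * y"]) (use assms in auto)
  then show ?thesis
    by (simp add: prod.distrib card_Diff_singleton)
qed

lemma card_nth_roots_le:
  fixes a :: "'a::idom"
  assumes "n > 0"
  shows "card {x. x ^ n = a} \<le> n"
proof -
  define P where "P = monom 1 n - [:a:]"
  have "coeff P n = 1"
    using assms by (simp add: P_def coeff_eq_0)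
  then have "P \<noteq> 0"
    by auto
  moreover have "{x. x ^ n = a} = {x. poly P x = 0}"
    by (simp add: P_def poly_monom)
  ultimately have "card {x. x ^ n = a} \<le> degree P"
    using card_poly_roots_bound by metis
  also have "\<dots> \<le> n"
    unfolding P_def by (intro degree_diff_le) (auto simp: degree_monom_le)
  finally show ?thesis .
qed

lemma ex_power_neq_1:
  assumes "\<not> CARD('a::{field,finite}) - 1 dvd n"
  shows "\<exists>z::'a. z \<noteq> 0 \<and> z ^ n \<noteq> 1"
proof (rule ccontr)
  define N where "N = CARD('a) - 1"
  define r where "r = n mod N"
  assume "\<nexists>z::'a. z \<noteq> 0 \<and> z ^ n \<noteq> 1"
  moreover have "z ^ n = z ^ r" if "z \<noteq> 0" for z :: 'a
  proof -
    have "z ^ n = (z ^ N) ^ (n div N) * z ^ r"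
      by (simp add: r_def flip: power_mult power_add)
    then show ?thesis
      using power_card_minus_1_eq_1[OF that] by (simp add: N_def)
  qed
  ultimately have "UNIV - {0} \<subseteq> {z :: 'a. z ^ r = 1}"
    by auto
  then have "card (UNIV - {0 :: 'a}) \<le> card {z :: 'a. z ^ r = 1}"
    by (rule card_mono[rotated]) simp
  then have "N \<le> card {z :: 'a. z ^ r = 1}"
    by (simp add: N_def card_Diff_singleton)
  moreover have "r > 0" "r < N"
    using assms card_field_gt_1[where 'a = 'a] by (auto simp: r_def N_def dvd_eq_mod_eq_0)
  ultimately show False
    using card_nth_roots_le[of r "1 :: 'a"] by simp
qed

lemma ex_power_neq_1_if_card_eq:
  assumes "CARD('a::{field,finite}) = n * m + 1" "n > 1"
  shows "\<exists>z::'a. z \<noteq> 0 \<and> z ^ m \<noteq> 1"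
proof (rule ex_power_neq_1)
  have "m > 0"
    using assms(1) card_field_gt_1[where 'a = 'a] by (auto intro: Nat.gr0I)
  then have "m < n * m"
    using \<open>n > 1\<close> by simp
  then show "\<not> CARD('a) - 1 dvd m"
    using assms(1) \<open>m > 0\<close> by (simp add: nat_dvd_not_less)
qed

text \<open>Both sides describe sets of \<open>m\<close> elements: every nonzero \<open>n\<close>-th power has at most \<open>n\<close> roots, so there
  are at least \<open>m\<close> such powers, all of them among the at most \<open>m\<close> solutions of \<open>u\<^bsup>m\<^esup> = 1\<close>.\<close>
lemma power_eq_1_iff_nth_power:
  fixes u :: "'a::{field,finite}"
  assumes "CARD('a) = n * m + 1" "u \<noteq> 0"
  shows "u ^ m = 1 \<longleftrightarrow> (\<exists>y. y ^ n = u)"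
proof -
  define C where "C = (\<lambda>y :: 'a. y ^ n) ` (UNIV - {0})"
  have "n > 0" "m > 0"
    using assms(1) card_field_gt_1[where 'a = 'a] by (auto intro: Nat.gr0I)
  have "n * m = (\<Sum>y\<in>UNIV - {0 :: 'a}. 1)"
    using assms(1) by (simp add: card_Diff_singleton)
  also have "\<dots> = (\<Sum>v\<in>C. card {y \<in> UNIV - {0}. y ^ n = v})"
    using sum_fun_comp[of "UNIV - {0 :: 'a}" C "\<lambda>y. y ^ n" "\<lambda>_. 1 :: nat"] by (simp add: C_def)
  also have "\<dots> \<le> (\<Sum>v\<in>C. n)"
  proof (rule sum_mono)
    fix v :: 'a
    have "card {y \<in> UNIV - {0}. y ^ n = v} \<le> card {y. y ^ n = v}"
      by (rule card_mono) auto
    then show "card {y \<in> UNIV - {0}. y ^ n = v} \<le> n"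
      using card_nth_roots_le[OF \<open>n > 0\<close>, of v] by simp
  qed
  finally have "m \<le> card C"
    using \<open>n > 0\<close> by (simp add: mult.commute[of _ n])
  moreover have "C \<subseteq> {x. x ^ m = 1}"
    using assms(1) power_card_minus_1_eq_1[where 'a = 'a] by (auto simp: C_def simp flip: power_mult)
  ultimately have "C = {x. x ^ m = 1}"
    using card_nth_roots_le[OF \<open>m > 0\<close>, of "1 :: 'a"] by (intro card_seteq) auto
  moreover have "u \<in> C \<longleftrightarrow> (\<exists>y. y ^ n = u)"
    using \<open>u \<noteq> 0\<close> \<open>n > 0\<close> by (auto simp: C_def)
  ultimately show ?thesis
    by blast
qed

lemma sum_UNIV_shift:
  fixes f :: "'a::{ab_group_add,finite} \<Rightarrow> 'b::comm_monoid_add"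
  shows "(\<Sum>x\<in>UNIV. f (x + a)) = (\<Sum>x\<in>UNIV. f x)"
  by (rule sum.reindex_bij_witness[of _ "\<lambda>x. x - a" "\<lambda>x. x + a"]) auto

lemma sum_UNIV_reflect:
  fixes f :: "'a::{ab_group_add,finite} \<Rightarrow> 'b::comm_monoid_add"
  shows "(\<Sum>x\<in>UNIV. f (a - x)) = (\<Sum>x\<in>UNIV. f x)"
  by (rule sum.reindex_bij_witness[of _ "\<lambda>x. a - x" "\<lambda>x. a - x"]) auto

lemma sum_UNIV_scale:
  fixes f :: "'a::{field,finite} \<Rightarrow> 'b::comm_monoid_add"
  assumes "a \<noteq> 0"
  shows "(\<Sum>x\<in>UNIV. f (a * x)) = (\<Sum>x\<in>UNIV. f x)"
  by (rule sum.reindex_bij_witness[of _ "\<lambda>x. x / a" "\<lambda>x. a * x"]) (use assms in auto)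

lemma sum_UNIV_power:
  "(\<Sum>x::'a::{field,finite}\<in>UNIV. x ^ n) = (if n > 0 \<and> CARD('a) - 1 dvd n then -1 else 0)"
proof -
  consider (zero) "n = 0" | (dvd) "n > 0" "CARD('a) - 1 dvd n" | (not_dvd) "\<not> CARD('a) - 1 dvd n"
    by blast
  then show ?thesis
  proof cases
    case zero
    then show ?thesis
      using of_nat_card_eq_0[where 'a = 'a] by simp
  next
    case dvd
    then have "x ^ n = 1" if "x \<noteq> 0" for x :: 'a
      using power_card_minus_1_eq_1[OF that] by (auto simp: power_mult)
    then have "(\<Sum>x::'a\<in>UNIV. x ^ n) = (\<Sum>x\<in>UNIV - {0 :: 'a}. 1)"
      using dvd by (intro sum.mono_neutral_cong_right) auto
    also have "\<dots> = of_nat CARD('a) - 1"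
      using card_field_gt_1[where 'a = 'a] by (simp add: card_Diff_singleton of_nat_diff)
    finally show ?thesis
      using dvd of_nat_card_eq_0[where 'a = 'a] by simp
  next
    case not_dvd
    then obtain z :: 'a where z: "z \<noteq> 0" "z ^ n \<noteq> 1"
      using ex_power_neq_1 by blast
    have "(\<Sum>x::'a\<in>UNIV. x ^ n) = z ^ n * (\<Sum>x::'a\<in>UNIV. x ^ n)"
      using sum_UNIV_scale[OF z(1), of "\<lambda>x. x ^ n"] by (simp add: power_mult_distrib sum_distrib_left)
    then show ?thesis
      using z not_dvd by simp
  qed
qed

lemma dvd_add_iff_eq_diff:
  fixes a j n :: nat
  assumes "0 < a" "a \<le> n" "a + j < 2 * n"
  shows "n dvd a + j \<longleftrightarrow> j = n - a"
proof
  assume "n dvd a + j"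
  then obtain i where multiple: "a + j = n * i" ..
  then have "n * i < n * 2" "i \<noteq> 0"
    using assms by (linarith, intro notI, simp)
  then have "i = 1"
    by simp
  then show "j = n - a"
    using multiple by simp
next
  assume "j = n - a"
  then show "n dvd a + j"
    using assms by simp
qed

lemma sum_UNIV_power_mult_power:
  fixes a b :: nat
  assumes "0 < a" "a \<le> CARD('a) - 1" "a + b < 2 * (CARD('a) - 1)"
  shows "(\<Sum>x::'a::{field,finite}\<in>UNIV. x ^ a * (1 - x) ^ b)
    = - ((- 1) ^ (CARD('a) - 1 - a) * of_nat (b choose (CARD('a) - 1 - a)))"
proof -
  define N where "N = CARD('a) - 1"
  have expand: "x ^ a * (1 - x) ^ b = (\<Sum>j\<le>b. of_nat (b choose j) * (- 1) ^ j * x ^ (a + j))" for x :: 'a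
    using binomial_ring[of "- x" 1 b]
    by (simp add: sum_distrib_left power_add power_minus[of x] mult_ac)
  have power_sum: "(\<Sum>x::'a\<in>UNIV. x ^ (a + j)) = (if j = N - a then -1 else 0)" if "j \<le> b" for j
    using dvd_add_iff_eq_diff[of a N j] assms that by (simp add: sum_UNIV_power N_def)
  have "(\<Sum>x::'a\<in>UNIV. x ^ a * (1 - x) ^ b)
      = (\<Sum>j\<le>b. of_nat (b choose j) * (- 1) ^ j * (\<Sum>x::'a\<in>UNIV. x ^ (a + j)))"
    unfolding expand by (simp add: sum.swap[of _ UNIV] sum_distrib_left)
  also have "\<dots> = (\<Sum>j\<le>b. if j = N - a then - (of_nat (b choose j) * (- 1) ^ j) else 0)"
    by (rule sum.cong) (simp_all add: power_sum)
  also have "\<dots> = - ((- 1) ^ (N - a) * of_nat (b choose (N - a)))"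
    by (simp add: binomial_eq_0 mult.commute)
  finally show ?thesis
    by (simp only: N_def)
qed

section \<open>Binomial coefficients in prime characteristic\<close>

lemma coeff_one_plus_X_power:
  "coeff ([:1, 1:] ^ n) i = (of_nat (n choose i) :: 'a::comm_semiring_1)"
  by (cases "i \<le> n") (simp_all add: coeff_linear_poly_power coeff_eq_0 degree_linear_power binomial_eq_0)

lemma one_plus_X_power_CHAR_mult:
  fixes p :: nat
  defines "p \<equiv> CHAR('a::comm_ring_1)"
  assumes "prime p"
  shows "([:1, 1:] :: 'a poly) ^ (p * n) = (\<Sum>i\<le>n. monom (of_nat (n choose i)) (p * i))"
proof -
  have "([:1, 1:] :: 'a poly) = 1 + monom 1 1"
    by (simp add: one_pCons monom_Suc monom_0)
  then have "([:1, 1:] :: 'a poly) ^ p = monom 1 p + 1"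
    using freshmans_dream[of p "1 :: 'a poly" "monom 1 1"] \<open>prime p\<close>
    by (simp add: p_def monom_power add.commute)
  then show ?thesis
    by (simp add: power_mult binomial_ring monom_power of_nat_monom mult_monom)
qed

lemma of_nat_binomial_Lucas:
  fixes p :: nat
  defines "p \<equiv> CHAR('a::comm_ring_1)"
  assumes "prime p" "r < p" "s < p"
  shows "(of_nat ((p * n + r) choose (p * m + s)) :: 'a) = of_nat (n choose m) * of_nat (r choose s)"
proof -
  have summand: "coeff (monom (of_nat (n choose i)) (p * i) * ([:1, 1:] :: 'a poly) ^ r) (p * m + s)
      = (if i = m then of_nat (n choose i) * of_nat (r choose s) else 0)" for i
  proof (cases i m rule: linorder_cases)
    case less
    then have "p * Suc i \<le> p * m"
      by (intro mult_le_mono2) simp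
    then have "r < p * m + s - p * i"
      using \<open>r < p\<close> by simp
    then show ?thesis
      using less by (simp add: coeff_monom_mult coeff_one_plus_X_power binomial_eq_0)
  next
    case equal
    then show ?thesis
      by (simp add: coeff_monom_mult coeff_one_plus_X_power)
  next
    case greater
    then have "p * Suc m \<le> p * i"
      by (intro mult_le_mono2) simp
    then show ?thesis
      using greater \<open>s < p\<close> by (simp add: coeff_monom_mult)
  qed
  have "([:1, 1:] :: 'a poly) ^ (p * n + r) = (\<Sum>i\<le>n. monom (of_nat (n choose i)) (p * i) * [:1, 1:] ^ r)"
    using one_plus_X_power_CHAR_mult[where 'a = 'a] \<open>prime p\<close>
    by (simp add: power_add sum_distrib_right p_def)
  then have "coeff (([:1, 1:] :: 'a poly) ^ (p * n + r)) (p * m + s)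
      = (\<Sum>i\<le>n. if i = m then of_nat (n choose i) * of_nat (r choose s) else 0)"
    by (simp add: coeff_sum summand)
  also have "\<dots> = of_nat (n choose m) * of_nat (r choose s)"
    by (simp add: binomial_eq_0)
  finally show ?thesis
    by (simp only: coeff_one_plus_X_power)
qed

lemma ex_power_eq_mult_3_plus_1:
  fixes p :: nat
  assumes "[p = 1] (mod 3)"
  shows "\<exists>n. p ^ k = 3 * n + 1"
proof -
  have "[p ^ k = 1] (mod 3)"
    using cong_pow[OF assms, of k] by simp
  then have "p ^ k = 3 * (p ^ k div 3) + 1"
    using div_mult_mod_eq[of "p ^ k" 3] by (simp add: cong_def)
  then show ?thesis ..
qed

text \<open>The base \<open>p\<close> digits of \<open>m\<close> all equal \<open>(p - 1) / 3\<close>, so adding \<open>m + m\<close> causes no carries.\<close>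
lemma of_nat_central_binomial_neq_0:
  fixes p :: nat
  defines "p \<equiv> CHAR('a::idom)"
  assumes "prime p" "[p = 1] (mod 3)" "p ^ k = 3 * m + 1"
  shows "(of_nat (2 * m choose m) :: 'a) \<noteq> 0"
  using \<open>p ^ k = 3 * m + 1\<close>
proof (induction k arbitrary: m)
  case 0
  then show ?case
    by simp
next
  case (Suc k)
  obtain r n where p_eq: "p = 3 * r + 1" and power_eq: "p ^ k = 3 * n + 1"
    using ex_power_eq_mult_3_plus_1[OF assms(3), of 1] ex_power_eq_mult_3_plus_1[OF assms(3), of k] by auto
  have "3 * m + 1 = p * (3 * n + 1)"
    using Suc.prems power_eq by simp
  then have m_eq: "m = p * n + r"
    using p_eq by (simp add: distrib_left)
  have "\<not> p dvd (2 * r choose r)"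
  proof
    assume "p dvd (2 * r choose r)"
    then have "p dvd fact r * fact (2 * r - r) * (2 * r choose r)"
      by (rule dvd_mult)
    then have "p dvd fact (2 * r)"
      by (subst (asm) binomial_fact_lemma) simp_all
    then show False
      using prime_dvd_fact_iff[OF \<open>prime p\<close>] p_eq by simp
  qed
  then have "(of_nat (2 * r choose r) :: 'a) \<noteq> 0"
    by (simp add: of_nat_eq_0_iff_char_dvd p_def)
  moreover have "(of_nat (2 * m choose m) :: 'a) = of_nat (2 * n choose n) * of_nat (2 * r choose r)"
  proof -
    have "2 * m = p * (2 * n) + 2 * r"
      using m_eq by simp
    then show ?thesis
      using of_nat_binomial_Lucas[where 'a = 'a, of "2 * r" r "2 * n" n] \<open>prime p\<close> p_eq m_eq
      by (simp flip: p_def)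
  qed
  ultimately show ?case
    using Suc.IH[OF power_eq] by simp
qed

section \<open>Multiplicative characters and Jacobi sums\<close>

locale mult_character =
  fixes \<chi> :: "'a::{field,finite} \<Rightarrow> complex"
  assumes zero [simp]: "\<chi> 0 = 0"
    and one [simp]: "\<chi> 1 = 1"
    and mult: "\<chi> (x * y) = \<chi> x * \<chi> y"
begin

lemma power: "\<chi> (x ^ n) = \<chi> x ^ n"
  by (induction n) (simp_all add: mult)

lemma mult_cnj:
  assumes "x \<noteq> 0"
  shows "\<chi> x * cnj (\<chi> x) = 1"
proof -
  have "\<chi> x ^ (CARD('a) - 1) = 1"
    using power_card_minus_1_eq_1[OF assms] by (simp flip: power)
  then have "norm (\<chi> x) = 1"
    using power_eq_1_iff card_field_gt_1[where 'a = 'a] by fastforce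
  then show ?thesis
    by (simp add: complex_norm_square[symmetric])
qed

lemma divide: "\<chi> (x / y) = \<chi> x * cnj (\<chi> y)"
proof (cases "y = 0")
  case False
  have "\<chi> x * cnj (\<chi> y) = \<chi> (x / y) * (\<chi> y * cnj (\<chi> y))"
    using mult[of "x / y" y] False by simp
  then show ?thesis
    using mult_cnj[OF False] by simp
qed simp

lemma mult_character_cnj: "mult_character (\<lambda>x. cnj (\<chi> x))"
  by unfold_locales (simp_all add: mult)

end

locale nontrivial_character = mult_character +
  assumes nontrivial: "\<exists>x. x \<noteq> 0 \<and> \<chi> x \<noteq> 1"
begin

lemma sum_eq_0: "(\<Sum>x\<in>UNIV. \<chi> x) = 0"
proof -
  obtain z where z: "z \<noteq> 0" "\<chi> z \<noteq> 1"
    using nontrivial by blast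
  have "(\<Sum>x\<in>UNIV. \<chi> x) = \<chi> z * (\<Sum>x\<in>UNIV. \<chi> x)"
    using sum_UNIV_scale[OF z(1), of \<chi>] by (simp add: mult sum_distrib_left)
  then show ?thesis
    using z by simp
qed

lemma sum_affine_mult_cnj:
  "(\<Sum>y\<in>UNIV. \<chi> (a + t * y) * cnj (\<chi> y)) = (if a = 0 then of_nat CARD('a) * \<chi> t else 0) - \<chi> t"
proof (cases "a = 0")
  case True
  have "(\<Sum>y\<in>UNIV. \<chi> (a + t * y) * cnj (\<chi> y)) = (\<Sum>y\<in>UNIV - {0 :: 'a}. \<chi> t)"
    using True mult_cnj by (intro sum.mono_neutral_cong_right) (auto simp: mult mult.assoc)
  then show ?thesis
    using True card_field_gt_1[where 'a = 'a]
    by (simp add: card_Diff_singleton of_nat_diff algebra_simps)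
next
  case False
  have "(\<Sum>y\<in>UNIV. \<chi> (a + t * y) * cnj (\<chi> y)) = (\<Sum>y\<in>UNIV - {0}. \<chi> (a / y + t))"
  proof (rule sum.mono_neutral_cong_right)
    fix y :: 'a assume "y \<in> UNIV - {0}"
    then have "a / y + t = (a + t * y) / y"
      by (simp add: field_simps)
    then show "\<chi> (a + t * y) * cnj (\<chi> y) = \<chi> (a / y + t)"
      by (simp only: divide)
  qed auto
  also have "\<dots> = (\<Sum>u\<in>UNIV - {t}. \<chi> u)"
    by (rule sum.reindex_bij_witness[of _ "\<lambda>u. a / (u - t)" "\<lambda>y. a / y + t"]) (use False in auto)
  also have "\<dots> = - \<chi> t"
    using sum_eq_0 by (simp add: sum_diff1)
  finally show ?thesis
    using False by simp
qed

lemma nontrivial_character_cnj: "nontrivial_character (\<lambda>x. cnj (\<chi> x))"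
  using mult_character_cnj nontrivial
  by (auto simp: nontrivial_character_def nontrivial_character_axioms_def)

end

definition jacobi_sum :: "('a::{field,finite} \<Rightarrow> complex) \<Rightarrow> ('a \<Rightarrow> complex) \<Rightarrow> complex" where
  "jacobi_sum \<chi> \<psi> = (\<Sum>x\<in>UNIV. \<chi> x * \<psi> (1 - x))"

lemma (in mult_character) jacobi_sum_mult_cnj_character:
  assumes "y \<noteq> 0"
  shows "jacobi_sum \<chi> g * cnj (\<chi> y) = (\<Sum>t\<in>UNIV. \<chi> t * g (1 - t * y))"
proof -
  have "jacobi_sum \<chi> g = (\<Sum>t\<in>UNIV. \<chi> (y * t) * g (1 - y * t))"
    unfolding jacobi_sum_def by (rule sum_UNIV_scale[OF assms, symmetric])
  also have "\<dots> = \<chi> y * (\<Sum>t\<in>UNIV. \<chi> t * g (1 - t * y))"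
    by (simp add: mult sum_distrib_left mult_ac)
  finally show ?thesis
    using mult_cnj[OF assms] by (simp add: mult_ac)
qed

lemma (in nontrivial_character) sum_one_minus_mult_cnj:
  "(\<Sum>y\<in>UNIV - {0}. \<chi> (1 - t * y) * cnj (\<chi> (1 - y))) = (if t = 1 then of_nat CARD('a) else 0) - \<chi> t - 1"
proof -
  have "(\<Sum>y\<in>UNIV. \<chi> (1 - t * y) * cnj (\<chi> (1 - y))) = (\<Sum>y\<in>UNIV. \<chi> ((1 - t) + t * y) * cnj (\<chi> y))"
    by (subst sum_UNIV_reflect[of _ 1, symmetric]) (simp add: algebra_simps)
  also have "\<dots> = (if t = 1 then of_nat CARD('a) else 0) - \<chi> t"
    by (simp add: sum_affine_mult_cnj)
  finally show ?thesis
    by (simp add: sum_diff1)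
qed

text \<open>In the double sum over \<open>x\<close> and \<open>y\<close>, substitute \<open>x = t y\<close> and sum over \<open>y\<close> first.\<close>
theorem jacobi_sum_mult_cnj:
  fixes \<chi> \<psi> :: "'a::{field,finite} \<Rightarrow> complex"
  assumes "nontrivial_character \<chi>" "nontrivial_character \<psi>"
    and prod: "nontrivial_character (\<lambda>x. \<chi> x * \<psi> x)"
  shows "jacobi_sum \<chi> \<psi> * cnj (jacobi_sum \<chi> \<psi>) = of_nat CARD('a)"
proof -
  interpret \<chi>: nontrivial_character \<chi> by fact
  interpret \<psi>: nontrivial_character \<psi> by fact
  define J where "J = jacobi_sum \<chi> \<psi>"
  define R where "R t y = \<psi> (1 - t * y) * cnj (\<psi> (1 - y))" for t y
  have "J * cnj J = (\<Sum>y\<in>UNIV. J * cnj (\<chi> y) * cnj (\<psi> (1 - y)))"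
    by (subst (2) J_def) (simp add: jacobi_sum_def sum_distrib_left mult.assoc)
  also have "\<dots> = (\<Sum>y\<in>UNIV - {0}. \<Sum>t\<in>UNIV. \<chi> t * R t y)"
    by (rule sum.mono_neutral_cong_right)
      (auto simp: J_def R_def \<chi>.jacobi_sum_mult_cnj_character sum_distrib_right mult.assoc)
  also have "\<dots> = (\<Sum>t\<in>UNIV. \<chi> t * (\<Sum>y\<in>UNIV - {0}. R t y))"
    by (subst sum.swap) (simp add: sum_distrib_left)
  also have "\<dots> = (\<Sum>t\<in>UNIV. (if t = 1 then of_nat CARD('a) else 0) - \<chi> t * \<psi> t - \<chi> t)"
    unfolding R_def \<psi>.sum_one_minus_mult_cnj by (rule sum.cong) (simp_all add: right_diff_distrib)
  also have "\<dots> = of_nat CARD('a)"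
    using \<chi>.sum_eq_0 nontrivial_character.sum_eq_0[OF prod] by (simp add: sum_subtractf)
  finally show ?thesis
    by (simp only: J_def)
qed

lemma sum_mult_diff_eq_jacobi_sum:
  assumes "mult_character \<chi>" "mult_character \<psi>" "s \<noteq> 0"
  shows "(\<Sum>x\<in>UNIV. \<chi> x * \<psi> (s - x)) = \<chi> s * \<psi> s * jacobi_sum \<chi> \<psi>"
proof -
  interpret \<chi>: mult_character \<chi> by fact
  interpret \<psi>: mult_character \<psi> by fact
  have "(\<Sum>x\<in>UNIV. \<chi> x * \<psi> (s - x)) = (\<Sum>x\<in>UNIV. \<chi> (s * x) * \<psi> (s - s * x))"
    by (rule sum_UNIV_scale[OF \<open>s \<noteq> 0\<close>, symmetric])
  also have "\<dots> = (\<Sum>x\<in>UNIV. \<chi> s * \<psi> s * (\<chi> x * \<psi> (1 - x)))"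
  proof (rule sum.cong)
    fix x
    have "s - s * x = s * (1 - x)"
      by (simp add: algebra_simps)
    then show "\<chi> (s * x) * \<psi> (s - s * x) = \<chi> s * \<psi> s * (\<chi> x * \<psi> (1 - x))"
      by (simp only: \<chi>.mult \<psi>.mult mult_ac)
  qed simp
  finally show ?thesis
    by (simp add: jacobi_sum_def sum_distrib_left)
qed

text \<open>For multiplicative characters this is the sum \<open>J\<^sub>0\<close> of Ireland and Rosen.\<close>
definition zero_sum :: "('a::{ab_group_add,finite} \<Rightarrow> 'b) \<Rightarrow> ('a \<Rightarrow> 'b) \<Rightarrow> ('a \<Rightarrow> 'b) \<Rightarrow> 'b::comm_semiring_1" where
  "zero_sum f g h = (\<Sum>x\<in>UNIV. \<Sum>y\<in>UNIV. f x * g y * h (- x - y))"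

lemma of_nat_card_sum_eq_0:
  fixes F G H :: "'a::finite \<Rightarrow> 'b::{ab_group_add,finite}"
  shows "of_nat (card {(x, y, z). F x + G y + H z = 0})
    = zero_sum (\<lambda>u. of_nat (card {x. F x = u})) (\<lambda>u. of_nat (card {x. G x = u})) (\<lambda>u. of_nat (card {x. H x = u}))"
proof -
  define S where "S = (\<lambda>(u, v). {x. F x = u} \<times> {y. G y = v} \<times> {z. H z = - u - v})"
  have "{(x, y, z). F x + G y + H z = 0} = (\<Union>uv. S uv)"
    by (auto simp: S_def eq_neg_iff_add_eq_0 algebra_simps)
  then have "card {(x, y, z). F x + G y + H z = 0} = (\<Sum>uv\<in>UNIV. card (S uv))"
    by (simp only:, intro card_UN_disjoint) (auto simp: S_def)
  also have "\<dots> = (\<Sum>u\<in>UNIV. \<Sum>v\<in>UNIV. card (S (u, v)))"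
    by (simp add: sum.cartesian_product)
  finally show ?thesis
    by (simp add: S_def zero_sum_def card_cartesian_product mult.assoc)
qed

lemma zero_sum_add:
  "zero_sum (\<lambda>x. f x + f' x) g h = zero_sum f g h + zero_sum f' g h"
  "zero_sum f (\<lambda>x. g x + g' x) h = zero_sum f g h + zero_sum f g' h"
  "zero_sum f g (\<lambda>x. h x + h' x) = zero_sum f g h + zero_sum f g h'"
  by (simp_all add: zero_sum_def sum.distrib algebra_simps)

lemma zero_sum_scale:
  "zero_sum (\<lambda>x. a * f x) g h = a * zero_sum f g h"
  "zero_sum f (\<lambda>x. a * g x) h = a * zero_sum f g h"
  "zero_sum f g (\<lambda>x. a * h x) = a * zero_sum f g h"
  by (simp_all add: zero_sum_def sum_distrib_left mult_ac)

lemma cnj_zero_sum: "cnj (zero_sum f g h) = zero_sum (\<lambda>x. cnj (f x)) (\<lambda>x. cnj (g x)) (\<lambda>x. cnj (h x))"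
  by (simp add: zero_sum_def)

lemma zero_sum_one_plus:
  fixes f g h :: "'a::{ab_group_add,finite} \<Rightarrow> 'b::comm_ring_1"
  assumes "(\<Sum>x\<in>UNIV. f x) = 0" "(\<Sum>x\<in>UNIV. g x) = 0" "(\<Sum>x\<in>UNIV. h x) = 0"
  shows "zero_sum (\<lambda>x. 1 + f x) (\<lambda>x. 1 + g x) (\<lambda>x. 1 + h x) = of_nat CARD('a) ^ 2 + zero_sum f g h"
proof -
  have shift: "(\<Sum>y\<in>UNIV. h (- x - y)) = 0" "(\<Sum>y\<in>UNIV. h (- y - x)) = 0" for x
    using sum_UNIV_reflect[of h "- x"] assms(3) by (simp_all add: minus_diff_commute[of _ x])
  have "zero_sum (\<lambda>_. 1) f' h = 0" "zero_sum f' (\<lambda>_. 1) h = 0" for f'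
    by (simp_all add: zero_sum_def shift flip: sum_distrib_left)
      (subst sum.swap, simp add: shift flip: sum_distrib_left)
  moreover have "zero_sum f g (\<lambda>_. 1) = 0" "zero_sum f (\<lambda>_. 1) (\<lambda>_. 1) = 0" "zero_sum (\<lambda>_. 1) g (\<lambda>_. 1) = 0"
    using assms by (simp_all add: zero_sum_def flip: sum_distrib_left sum_distrib_right)
  moreover have "zero_sum (\<lambda>_ :: 'a. 1) (\<lambda>_. 1) (\<lambda>_. 1 :: 'b) = of_nat CARD('a) ^ 2"
    by (simp add: zero_sum_def power2_eq_square)
  ultimately show ?thesis
    unfolding zero_sum_add by simp
qed

lemma zero_sum_eq_0:
  assumes "mult_character f" "mult_character g" "mult_character h"
    and z: "z \<noteq> 0" "f z * g z * h z \<noteq> 1"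
  shows "zero_sum f g h = 0"
proof -
  interpret f: mult_character f by fact
  interpret g: mult_character g by fact
  interpret h: mult_character h by fact
  have "zero_sum f g h = (\<Sum>x\<in>UNIV. \<Sum>y\<in>UNIV. f x * g (z * y) * h (- x - z * y))"
    unfolding zero_sum_def by (rule sum.cong[OF refl], rule sum_UNIV_scale[OF z(1), symmetric])
  also have "\<dots> = (\<Sum>x\<in>UNIV. \<Sum>y\<in>UNIV. f (z * x) * g (z * y) * h (- (z * x) - z * y))"
    by (rule sum_UNIV_scale[OF z(1), symmetric])
  also have "\<dots> = (\<Sum>x\<in>UNIV. \<Sum>y\<in>UNIV. (f z * g z * h z) * (f x * g y * h (- x - y)))"
  proof (intro sum.cong refl)
    fix x y
    have "- (z * x) - z * y = z * (- x - y)"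
      by (simp add: algebra_simps)
    then show "f (z * x) * g (z * y) * h (- (z * x) - z * y) = (f z * g z * h z) * (f x * g y * h (- x - y))"
      by (simp only: f.mult g.mult h.mult mult_ac)
  qed
  also have "\<dots> = (f z * g z * h z) * zero_sum f g h"
    by (simp only: zero_sum_def sum_distrib_left)
  finally show ?thesis
    using z(2) by simp
qed

lemma zero_sum_eq_jacobi_sum:
  fixes f g h :: "'a::{field,finite} \<Rightarrow> complex"
  assumes "mult_character f" "mult_character g" "mult_character h"
    and prod: "\<And>z. z \<noteq> 0 \<Longrightarrow> f z * g z * h z = 1"
  shows "zero_sum f g h = of_nat (CARD('a) - 1) * (h (- 1) * jacobi_sum f g)"
proof -
  interpret h: mult_character h by fact
  have "zero_sum f g h = (\<Sum>x\<in>UNIV. \<Sum>s\<in>UNIV. f x * g (s - x) * h (- s))"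
    unfolding zero_sum_def
  proof (rule sum.cong)
    fix x
    show "(\<Sum>y\<in>UNIV. f x * g y * h (- x - y)) = (\<Sum>s\<in>UNIV. f x * g (s - x) * h (- s))"
      using sum_UNIV_shift[of "\<lambda>y. f x * g y * h (- x - y)" "- x"] by simp
  qed simp
  also have "\<dots> = (\<Sum>s\<in>UNIV. h (- s) * (\<Sum>x\<in>UNIV. f x * g (s - x)))"
    by (subst sum.swap) (simp add: sum_distrib_left mult_ac)
  also have "\<dots> = (\<Sum>s\<in>UNIV - {0 :: 'a}. h (- 1) * jacobi_sum f g)"
  proof (rule sum.mono_neutral_cong_right)
    fix s :: 'a assume "s \<in> UNIV - {0}"
    then have "h (- s) * (f s * g s) = h (- 1)"
      using prod[of s] h.mult[of "- 1" s] by (simp add: mult_ac)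
    then show "h (- s) * (\<Sum>x\<in>UNIV. f x * g (s - x)) = h (- 1) * jacobi_sum f g"
      using \<open>s \<in> UNIV - {0}\<close> by (simp add: sum_mult_diff_eq_jacobi_sum[OF assms(1,2)] flip: mult.assoc)
  qed auto
  finally show ?thesis
    by (simp add: card_Diff_singleton)
qed

section \<open>The cubic residue character\<close>

definition omega :: complex where
  "omega = Complex (- 1 / 2) (sqrt 3 / 2)"

lemma cnj_omega: "cnj omega = omega\<^sup>2"
  by (simp add: omega_def complex_eq_iff power2_eq_square field_simps)

lemma omega_sum: "1 + omega + omega\<^sup>2 = 0"
  by (simp add: omega_def complex_eq_iff power2_eq_square field_simps)

lemma omega_cubed: "omega ^ 3 = 1"
  using omega_sum by algebra

locale cubic_residue =
  fixes w :: "'a::{field,finite}" and m :: nat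
  assumes card_field: "CARD('a) = 3 * m + 1"
    and w_sum: "w\<^sup>2 + w + 1 = 0"
begin

lemma m_pos: "m > 0"
  using card_field card_field_gt_1[where 'a = 'a] by simp

lemma w_cubed: "w ^ 3 = 1"
  using w_sum by algebra

lemma w_neq: "w \<noteq> 0" "w \<noteq> 1" "w\<^sup>2 \<noteq> 0" "w\<^sup>2 \<noteq> 1" "w \<noteq> w\<^sup>2"
proof -
  have three: "(3 :: 'a) \<noteq> 0"
    using of_nat_card_eq_0[where 'a = 'a] card_field by auto
  show "w \<noteq> 0"
    using w_sum by auto
  show "w \<noteq> 1"
    using w_sum three by auto
  show "w\<^sup>2 \<noteq> 0"
    using \<open>w \<noteq> 0\<close> by simp
  show "w\<^sup>2 \<noteq> 1"
    using w_cubed \<open>w \<noteq> 1\<close> by (metis mult_1 power2_eq_square power3_eq_cube)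
  show "w \<noteq> w\<^sup>2"
    using \<open>w \<noteq> 0\<close> \<open>w \<noteq> 1\<close> by (simp add: power2_eq_square)
qed

lemma cube_eq_iff: "y ^ 3 = z ^ 3 \<longleftrightarrow> y \<in> {z, z * w, z * w\<^sup>2}" for y z :: 'a
proof -
  have "y ^ 3 - z ^ 3 = (y - z) * (y - z * w) * (y - z * w\<^sup>2)"
    using w_sum by algebra
  then show ?thesis
    by (metis (no_types, lifting) empty_iff insert_iff mult_eq_0_iff right_minus_eq)
qed

lemma power_3m: "x ^ (3 * m) = 1" if "x \<noteq> 0" for x :: 'a
  using power_card_minus_1_eq_1[OF that] card_field by simp

lemma power_m_cases: "x ^ m \<in> {0, 1, w, w\<^sup>2}" for x :: 'a
proof (cases "x = 0")
  case True
  then show ?thesis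
    using m_pos by simp
next
  case False
  then have "(x ^ m) ^ 3 = 1 ^ 3"
    using power_3m[OF False] by (simp add: mult.commute flip: power_mult)
  then show ?thesis
    unfolding cube_eq_iff by simp
qed

definition root_lift :: "'a \<Rightarrow> complex" where
  "root_lift y = (if y = 0 then 0 else if y = 1 then 1 else if y = w then omega else omega\<^sup>2)"

lemma root_lift_simps [simp]:
  "root_lift 0 = 0" "root_lift 1 = 1" "root_lift w = omega" "root_lift (w\<^sup>2) = omega\<^sup>2"
  using w_neq by (simp_all add: root_lift_def)

lemma root_lift_mult:
  assumes "a \<in> {0, 1, w, w\<^sup>2}" "b \<in> {0, 1, w, w\<^sup>2}"
  shows "root_lift (a * b) = root_lift a * root_lift b"
proof -
  have "z * z = z\<^sup>2 \<and> z * z\<^sup>2 = 1 \<and> z\<^sup>2 * z = 1 \<and> z\<^sup>2 * z\<^sup>2 = z" if "z ^ 3 = 1" for z :: "'b::comm_ring_1"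
    using that by (simp add: power2_eq_square power3_eq_cube mult.assoc)
  from this[OF w_cubed] this[OF omega_cubed] show ?thesis
    using assms by (elim insertE emptyE) simp_all
qed

definition chi :: "'a \<Rightarrow> complex" where
  "chi x = root_lift (x ^ m)"

sublocale chi: nontrivial_character chi
proof
  show "chi 0 = 0" "chi 1 = 1"
    using m_pos by (simp_all add: chi_def zero_power)
  show "chi (x * y) = chi x * chi y" for x y
    using root_lift_mult[OF power_m_cases power_m_cases] by (simp add: chi_def power_mult_distrib)
  obtain z :: 'a where "z \<noteq> 0" "z ^ m \<noteq> 1"
    using ex_power_neq_1_if_card_eq[OF card_field] by auto
  moreover have "omega \<noteq> 1" "omega\<^sup>2 \<noteq> 1"
    by (simp_all add: omega_def complex_eq_iff power2_eq_square)
  ultimately show "\<exists>z. z \<noteq> 0 \<and> chi z \<noteq> 1"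
    by (auto simp: chi_def root_lift_def)
qed

lemma chi_cube: "x \<noteq> 0 \<Longrightarrow> chi (x ^ 3) = 1"
  using power_3m by (simp add: chi_def flip: power_mult)

lemma chi_minus_1: "chi (- 1) = 1"
  using chi_cube[of "- 1"] by simp

lemma chi_square: "chi x * chi x = cnj (chi x)"
proof (cases "x = 0")
  case False
  have "chi x * chi x = chi x ^ 3 * cnj (chi x)"
    using chi.mult_cnj[OF False] by (simp add: power3_eq_cube mult.assoc)
  also have "\<dots> = cnj (chi x)"
    using chi_cube[OF False] by (simp add: chi.power)
  finally show ?thesis .
qed simp

lemma card_cube_roots: "of_nat (card {x. x ^ 3 = u}) = 1 + chi u + cnj (chi u)"
proof -
  consider (zero) "u = 0" | (cube) "u \<noteq> 0" "u ^ m = 1" | (non_cube) "u \<noteq> 0" "u ^ m \<noteq> 1"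
    by blast
  then show ?thesis
  proof cases
    case zero
    then show ?thesis
      by simp
  next
    case cube
    then obtain z where "u = z ^ 3" "z \<noteq> 0"
      using power_eq_1_iff_nth_power[OF card_field] by fastforce
    then have "{x. x ^ 3 = u} = {z, z * w, z * w\<^sup>2}"
      using cube_eq_iff by blast
    then have "card {x. x ^ 3 = u} = 3"
      using \<open>z \<noteq> 0\<close> w_neq by simp
    then show ?thesis
      using cube by (simp add: chi_def)
  next
    case non_cube
    then have "{x. x ^ 3 = u} = {}"
      using power_eq_1_iff_nth_power[OF card_field] by blast
    moreover have "chi u = omega \<or> cnj (chi u) = omega"
      using non_cube cnj_omega by (auto simp: chi_def root_lift_def complex_eq_iff)
    then have "1 + chi u + cnj (chi u) = 0"
      using omega_sum by (auto simp: complex_eq_iff cnj_omega[symmetric])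
    ultimately show ?thesis
      by simp
  qed
qed

lemma zero_sum_chi:
  "zero_sum chi chi chi = of_nat (3 * m) * jacobi_sum chi chi"
  using zero_sum_eq_jacobi_sum[OF chi.mult_character_axioms chi.mult_character_axioms chi.mult_character_axioms]
    chi_minus_1 chi.mult_cnj card_field
  by (simp add: chi_square mult.commute)

lemma zero_sum_chi_plus_cnj:
  assumes "a1 \<noteq> 0" "a2 \<noteq> 0" "a3 \<noteq> 0"
  defines "g \<equiv> \<lambda>a x. cnj (chi a) * chi x + chi a * cnj (chi x)"
    and "z \<equiv> cnj (chi (a1 * a2 * a3)) * jacobi_sum chi chi"
  shows "zero_sum (g a1) (g a2) (g a3) = of_nat (3 * m) * (z + cnj z)"
proof -
  define chi' where "chi' x = cnj (chi x)" for x
  note characters = chi.mult_character_axioms chi.mult_character_cnj[folded chi'_def]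
  obtain y where y: "y \<noteq> 0" "chi y \<noteq> 1"
    using chi.nontrivial by blast
  then have "chi y * chi' y = 1" "chi' y * chi y = 1" "chi' y \<noteq> 1"
    using chi.mult_cnj by (auto simp: chi'_def mult.commute)
  then have mixed: "zero_sum chi chi chi' = 0" "zero_sum chi chi' chi = 0" "zero_sum chi' chi chi = 0"
      "zero_sum chi chi' chi' = 0" "zero_sum chi' chi chi' = 0" "zero_sum chi' chi' chi = 0"
    using y by (intro zero_sum_eq_0[OF _ _ _ y(1)] characters; simp add: mult.assoc)+
  have pure: "zero_sum chi' chi' chi' = cnj (zero_sum chi chi chi)"
    by (simp add: cnj_zero_sum chi'_def[abs_def])
  have g_eq: "g a = (\<lambda>x. cnj (chi a) * chi x + chi a * chi' x)" for a
    by (simp add: g_def chi'_def)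
  show ?thesis
    unfolding g_eq zero_sum_add zero_sum_scale mixed pure zero_sum_chi
    by (simp add: z_def chi.mult algebra_simps)
qed

theorem card_cubic_zeros:
  assumes "a1 \<noteq> 0" "a2 \<noteq> 0" "a3 \<noteq> 0"
  shows "real (card (cubic_zeros a1 a2 a3)) = (real CARD('a))\<^sup>2
    + (real CARD('a) - 1) * (2 * Re (cnj (chi (a1 * a2 * a3)) * jacobi_sum chi chi))"
proof -
  define g where "g a x = cnj (chi a) * chi x + chi a * cnj (chi x)" for a x
  define z where "z = cnj (chi (a1 * a2 * a3)) * jacobi_sum chi chi"
  have roots: "of_nat (card {x. a * x ^ 3 = u}) = 1 + g a u" if "a \<noteq> 0" for a u
  proof -
    have "{x. a * x ^ 3 = u} = {x. x ^ 3 = u / a}"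
      using that by (auto simp: field_simps)
    then show ?thesis
      by (simp add: card_cube_roots chi.divide g_def mult.commute)
  qed
  have sum_g: "(\<Sum>x\<in>UNIV. g a x) = 0" for a
    using chi.sum_eq_0 by (simp add: g_def sum.distrib flip: sum_distrib_left cnj_sum)
  have "complex_of_nat (card (cubic_zeros a1 a2 a3))
      = zero_sum (\<lambda>x. 1 + g a1 x) (\<lambda>x. 1 + g a2 x) (\<lambda>x. 1 + g a3 x)"
    unfolding cubic_zeros_def of_nat_card_sum_eq_0 roots[OF assms(1)] roots[OF assms(2)] roots[OF assms(3)] ..
  also have "\<dots> = (of_nat CARD('a))\<^sup>2 + zero_sum (g a1) (g a2) (g a3)"
    by (intro zero_sum_one_plus sum_g)
  also have "\<dots> = (of_nat CARD('a))\<^sup>2 + of_nat (3 * m) * (z + cnj z)"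
    using zero_sum_chi_plus_cnj[OF assms] by (simp add: z_def g_def[abs_def])
  also have "\<dots> = of_real ((real CARD('a))\<^sup>2 + (real CARD('a) - 1) * (2 * Re z))"
    using card_field by (simp add: complex_add_cnj)
  finally show ?thesis
    unfolding z_def by (metis of_real_eq_iff of_real_of_nat_eq)
qed

section \<open>Arithmetic of the cubic Jacobi sum\<close>

definition jacobi_fibre :: "'a \<Rightarrow> nat" where
  "jacobi_fibre e = card {x. (x * (1 - x)) ^ m = e}"

lemma sum_jacobi_fibre:
  fixes f :: "'a \<Rightarrow> 'b::comm_ring_1"
  assumes "f 0 = 0"
  shows "(\<Sum>x\<in>UNIV. f ((x * (1 - x)) ^ m))
    = of_nat (jacobi_fibre 1) * f 1 + of_nat (jacobi_fibre w) * f w + of_nat (jacobi_fibre (w\<^sup>2)) * f (w\<^sup>2)"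
proof -
  have "(\<Sum>x\<in>UNIV. f ((x * (1 - x)) ^ m))
      = (\<Sum>y\<in>{0, 1, w, w\<^sup>2}. of_nat (card {x \<in> UNIV. (x * (1 - x)) ^ m = y}) * f y)"
    by (rule sum_fun_comp) (simp_all add: power_m_cases image_subset_iff del: insert_iff)
  then show ?thesis
    using w_neq assms by (simp add: jacobi_fibre_def add_ac)
qed

lemma jacobi_fibre_sum_w:
  "of_nat (jacobi_fibre 1) + of_nat (jacobi_fibre w) * w + of_nat (jacobi_fibre (w\<^sup>2)) * w\<^sup>2 = 0"
  using sum_jacobi_fibre[of "\<lambda>y. y"] sum_UNIV_power_mult_power[of m m, where 'a = 'a] m_pos card_field
  by (simp add: power_mult_distrib binomial_eq_0)

lemma jacobi_fibre_sum_w2: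
  "of_nat (jacobi_fibre 1) + of_nat (jacobi_fibre w) * w\<^sup>2 + of_nat (jacobi_fibre (w\<^sup>2)) * w
    = - ((- 1) ^ m * of_nat (2 * m choose m))"
proof -
  have "(\<Sum>x::'a\<in>UNIV. ((x * (1 - x)) ^ m)\<^sup>2) = - ((- 1) ^ m * of_nat (2 * m choose m))"
    using sum_UNIV_power_mult_power[of "2 * m" "2 * m", where 'a = 'a] m_pos card_field
    by (simp add: power_mult_distrib mult.commute[of m] flip: power_mult)
  moreover have "(w\<^sup>2)\<^sup>2 = w"
    using w_cubed by algebra
  ultimately show ?thesis
    using sum_jacobi_fibre[of "\<lambda>y. y\<^sup>2"] by simp
qed

lemma inverse_one_minus_cycle:
  fixes x :: "'b::field"
  assumes "x \<noteq> 0" "1 - x \<noteq> 0"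
  shows "1 / (1 - 1 / (1 - 1 / (1 - x))) = x"
proof -
  have "1 / (1 - 1 / (1 - x)) = - ((1 - x) / x)"
    using assms by (simp add: field_simps)
  moreover have "1 - - ((1 - x) / x) = 1 / x"
    using assms by (simp add: field_simps)
  ultimately show ?thesis
    by simp
qed

text \<open>The map \<open>x \<mapsto> 1 / (1 - x)\<close> has order 3 and changes \<open>x (1 - x)\<close> by a cube; its fixed points are
  the solutions of \<open>x (1 - x) = 1\<close>.\<close>
lemma jacobi_fibre_cong:
  assumes "e \<noteq> 0"
  shows "[jacobi_fibre e = card {x :: 'a. e = 1 \<and> x * (1 - x) = 1}] (mod 3)"
proof -
  define T where "T x = 1 / (1 - x)" for x :: 'a
  define A where "A = {x :: 'a. (x * (1 - x)) ^ m = e}"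
  have neq: "x \<noteq> 0" "1 - x \<noteq> 0" if "x \<in> A" for x
    using that assms m_pos by (auto simp: A_def zero_power)
  have closed: "T x \<in> A" if "x \<in> A" for x
  proof -
    have "1 - T x = - x / (1 - x)"
      using neq[OF that] by (simp add: T_def field_simps)
    then have "T x * (1 - T x) = (- 1 / (1 - x)) ^ 3 * (x * (1 - x))"
      using neq[OF that] by (simp add: T_def power3_eq_cube)
    moreover have "((- 1 / (1 - x)) ^ 3) ^ m = 1"
      using neq[OF that] power_3m[of "- 1 / (1 - x)"] by (simp add: power_mult)
    ultimately have "(T x * (1 - T x)) ^ m = (x * (1 - x)) ^ m"
      by (metis mult_1 power_mult_distrib)
    then show ?thesis
      using that by (simp add: A_def)
  qed
  have order: "(T ^^ 3) x = x" if "x \<in> A" for x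
    using inverse_one_minus_cycle[OF neq[OF that]] by (simp add: T_def eval_nat_numeral)
  have "[card A = card {x \<in> A. T x = x}] (mod 3)"
    by (intro card_cong_card_fixed_points closed order) simp_all
  moreover have "T x = x \<longleftrightarrow> x * (1 - x) = 1" if "x \<in> A" for x
    using neq[OF that] by (auto simp: T_def field_simps)
  then have "{x \<in> A. T x = x} = {x :: 'a. e = 1 \<and> x * (1 - x) = 1}"
    by (auto simp: A_def)
  ultimately show ?thesis
    by (simp add: jacobi_fibre_def A_def)
qed

lemma jacobi_fibre_cong_0:
  assumes "e \<noteq> 0" "e \<noteq> 1"
  shows "[int (jacobi_fibre e) = 0] (mod 3)"
  using jacobi_fibre_cong[OF \<open>e \<noteq> 0\<close>] \<open>e \<noteq> 1\<close> by (simp flip: cong_int_iff)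

lemma jacobi_fibre_1_cong: "[int (jacobi_fibre 1) = 2] (mod 3)"
proof -
  have "x * (1 - x) = 1 \<longleftrightarrow> x \<in> {- w, - (w\<^sup>2)}" for x
  proof -
    have "x * (1 - x) - 1 = - ((x - (- w)) * (x - (- (w\<^sup>2))))"
      using w_sum by algebra
    then show ?thesis
      by (metis (no_types, lifting) empty_iff insert_iff mult_eq_0_iff neg_equal_0_iff_equal right_minus_eq)
  qed
  then have "{x. x * (1 - x) = 1} = {- w, - (w\<^sup>2)}"
    by blast
  then show ?thesis
    using jacobi_fibre_cong[of 1] w_neq by (simp flip: cong_int_iff)
qed

definition jacobi_c :: int where
  "jacobi_c = 2 * int (jacobi_fibre 1) - int (jacobi_fibre w) - int (jacobi_fibre (w\<^sup>2))"

definition jacobi_d :: int where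
  "jacobi_d = (int (jacobi_fibre w) - int (jacobi_fibre (w\<^sup>2))) div 3"

lemma three_jacobi_d: "3 * jacobi_d = int (jacobi_fibre w) - int (jacobi_fibre (w\<^sup>2))"
proof -
  have "[int (jacobi_fibre w) - int (jacobi_fibre (w\<^sup>2)) = 0 - 0] (mod 3)"
    using w_neq by (intro cong_diff jacobi_fibre_cong_0)
  then show ?thesis
    by (simp add: jacobi_d_def cong_0_iff)
qed

lemma jacobi_c_cong: "[jacobi_c = 1] (mod 3)"
proof -
  have "[jacobi_c = 2 * 2 - 0 - 0] (mod 3)"
    unfolding jacobi_c_def
    using w_neq by (intro cong_diff cong_mult cong_refl jacobi_fibre_1_cong jacobi_fibre_cong_0)
  then show ?thesis
    by (simp add: cong_def)
qed

lemma jacobi_sum_eq: "jacobi_sum chi chi = Complex (jacobi_c / 2) (3 * sqrt 3 / 2 * jacobi_d)"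
proof -
  have "jacobi_sum chi chi = of_nat (jacobi_fibre 1) + of_nat (jacobi_fibre w) * omega
      + of_nat (jacobi_fibre (w\<^sup>2)) * cnj omega"
    using sum_jacobi_fibre[of root_lift]
    by (simp add: jacobi_sum_def cnj_omega flip: chi.mult) (simp add: chi_def)
  moreover have "real (jacobi_fibre w) = real (jacobi_fibre (w\<^sup>2)) + 3 * real_of_int jacobi_d"
    using three_jacobi_d by linarith
  ultimately show ?thesis
    by (simp add: complex_eq_iff jacobi_c_def omega_def field_simps)
qed

lemma norm_equation: "4 * int CARD('a) = jacobi_c\<^sup>2 + 27 * jacobi_d\<^sup>2"
proof -
  have "jacobi_sum chi chi * cnj (jacobi_sum chi chi) = of_nat CARD('a)"
    using chi.nontrivial_character_axioms chi.nontrivial_character_cnj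
    by (intro jacobi_sum_mult_cnj) (simp_all add: chi_square)
  then have "real CARD('a) = (jacobi_c / 2)\<^sup>2 + (3 * sqrt 3 / 2 * jacobi_d)\<^sup>2"
    by (simp add: jacobi_sum_eq complex_eq_iff power2_eq_square)
  then have "real_of_int (4 * int CARD('a)) = real_of_int (jacobi_c\<^sup>2 + 27 * jacobi_d\<^sup>2)"
    by (simp add: power_mult_distrib power_divide)
  then show ?thesis
    by (simp only: of_int_eq_iff)
qed

lemma of_int_jacobi_c: "(of_int jacobi_c :: 'a) = - ((- 1) ^ m * of_nat (2 * m choose m))"
  unfolding jacobi_fibre_sum_w2[symmetric] jacobi_c_def of_int_diff of_int_mult of_int_of_nat_eq of_int_numeral
  using w_sum jacobi_fibre_sum_w by algebra

lemma of_int_nine_jacobi_d: "(of_int (9 * jacobi_d) :: 'a) = of_int jacobi_c * (2 * w + 1)"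
proof -
  have "(of_int (9 * jacobi_d) :: 'a) = 3 * of_int (3 * jacobi_d)"
    by simp
  also have "\<dots> = of_int jacobi_c * (2 * w + 1)"
    unfolding three_jacobi_d jacobi_c_def of_int_diff of_int_mult of_int_of_nat_eq of_int_numeral
    using w_sum jacobi_fibre_sum_w by algebra
  finally show ?thesis .
qed

lemma card_cubic_zeros_if_power_eq_1:
  fixes a1 a2 a3 :: 'a
  assumes "a1 \<noteq> 0" "a2 \<noteq> 0" "a3 \<noteq> 0" "(a1 * a2 * a3) ^ m = 1"
  shows "real (card (cubic_zeros a1 a2 a3)) = real CARD('a) ^ 2 + real_of_int jacobi_c * (real CARD('a) - 1)"
proof -
  have "chi (a1 * a2 * a3) = 1"
    using assms(4) by (simp add: chi_def)
  then show ?thesis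
    unfolding card_cubic_zeros[OF assms(1-3)] jacobi_sum_eq by simp
qed

lemma card_cubic_zeros_if_power_eq_w:
  fixes a1 a2 a3 :: 'a
  assumes "a1 \<noteq> 0" "a2 \<noteq> 0" "a3 \<noteq> 0" "(a1 * a2 * a3) ^ m = w"
  shows "real (card (cubic_zeros a1 a2 a3))
    = real CARD('a) ^ 2 + 1 / 2 * (real CARD('a) - 1) * (9 * real_of_int jacobi_d - real_of_int jacobi_c)"
proof -
  have "chi (a1 * a2 * a3) = omega"
    using assms(4) by (simp add: chi_def)
  moreover have "2 * Re (cnj omega * jacobi_sum chi chi) = 1 / 2 * (9 * real_of_int jacobi_d - real_of_int jacobi_c)"
    by (simp add: jacobi_sum_eq omega_def)
  ultimately show ?thesis
    unfolding card_cubic_zeros[OF assms(1-3)] by simp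
qed

end

section \<open>The sign of \<open>d\<close>\<close>

lemma sign_cong_iff:
  fixes A :: "'a::field"
  assumes "CHAR('a) = p" "odd p" "coprime c (int p)"
  shows "sign_cong p q A c d \<longleftrightarrow> (of_int (9 * d) :: 'a) = of_int c * (2 * A ^ ((q - 1) div 3) + 1)"
    (is "_ \<longleftrightarrow> _ = of_int c * (2 * ?B + 1)")
proof -
  have cong: "[x = y] (mod int p) \<longleftrightarrow> (of_int x :: 'a) = of_int y" for x y
    unfolding of_int_eq_iff_cong_CHAR assms(1) ..
  show ?thesis
  proof
    assume "sign_cong p q A c d"
    then obtain t where "of_int t = ?B" "[9 * d = c * (2 * t + 1)] (mod int p)"
      by (auto simp: sign_cong_def)
    then show "(of_int (9 * d) :: 'a) = of_int c * (2 * ?B + 1)"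
      by (simp add: cong)
  next
    assume eq: "(of_int (9 * d) :: 'a) = of_int c * (2 * ?B + 1)"
    have "coprime (2 * c) (int p)"
      using assms(2,3) by (simp add: coprime_left_2_iff_odd)
    then obtain v where "[2 * c * v = 1] (mod int p)"
      using cong_solve_coprime_int by blast
    then have inverse: "2 * of_int c * of_int v = (1 :: 'a)"
      by (simp add: cong)
    define t where "t = v * (9 * d - c)"
    have "(of_int t :: 'a) = of_int v * (of_int (9 * d) - of_int c)"
      by (simp add: t_def)
    also have "\<dots> = (2 * of_int c * of_int v) * ?B"
      unfolding eq by (simp add: algebra_simps)
    finally have of_int_t: "of_int t = ?B"
      by (simp add: inverse)
    then have "[9 * d = c * (2 * t + 1)] (mod int p)"
      using eq by (simp add: cong)
    then show "sign_cong p q A c d"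
      using of_int_t by (auto simp: sign_cong_def)
  qed
qed

lemma norm_rep_sign_cong_unique:
  fixes A :: "'a::field"
  assumes char: "CHAR('a) = p" and "prime p" "p > 3" "k > 0"
    and rep: "norm_rep p (p ^ k) c d" "norm_rep p (p ^ k) c' d'"
    and sign: "sign_cong p q A c d" "sign_cong p q A c' d'"
  shows "c' = c \<and> d' = d"
proof -
  have "odd p"
    using \<open>prime p\<close> \<open>p > 3\<close> prime_odd_nat by simp
  have coprime_c: "coprime c (int p)"
    using rep(1) by (simp add: norm_rep_def)
  have "c' = c" and "\<bar>d'\<bar> = \<bar>d\<bar>"
    using norm_rep_unique[OF \<open>prime p\<close> \<open>odd p\<close> \<open>k > 0\<close> rep] .
  have "d' = d"
  proof (rule ccontr)
    assume "d' \<noteq> d"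
    then have "d' = - d"
      using \<open>\<bar>d'\<bar> = \<bar>d\<bar>\<close> by (auto simp: abs_eq_iff)
    have "(of_int (9 * d') :: 'a) = of_int (9 * d)"
      using sign coprime_c \<open>c' = c\<close> by (simp only: sign_cong_iff[OF char \<open>odd p\<close>])
    then have "int p dvd 9 * d' - 9 * d"
      unfolding of_int_eq_iff_cong_CHAR char cong_iff_dvd_diff .
    also have "9 * d' - 9 * d = - (3 * (3 * (2 * d)))"
      by (simp add: \<open>d' = - d\<close>)
    finally have "int p dvd 3 * (3 * (2 * d))"
      by (simp only: dvd_minus_iff)
    moreover have "coprime (int p) 3" "coprime (int p) 2"
      using \<open>odd p\<close> \<open>prime p\<close> \<open>p > 3\<close> primes_coprime[of "int p" 3] by simp_all
    ultimately have "int p dvd d"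
      by (simp only: coprime_dvd_mult_right_iff)
    moreover have "\<not> int p dvd c"
      using coprime_c \<open>prime p\<close> by (auto dest: coprime_common_divisor)
    moreover have "int p dvd c\<^sup>2 + 27 * d\<^sup>2"
      using rep(1) \<open>k > 0\<close> by (metis norm_rep_def dvd_mult dvd_power of_nat_power)
    ultimately show False
      using prime_not_dvd_norm_form_snd[of "int p" c 27 d] \<open>prime p\<close> by simp
  qed
  with \<open>c' = c\<close> show ?thesis
    by blast
qed

section \<open>The number of points\<close>

locale cubic_residue_prime_power = cubic_residue w m for w :: "'a::{field,finite}" and m +
  fixes p k :: nat
  assumes prime: "prime p" and p_cong: "[p = 1] (mod 3)" and card_eq: "CARD('a) = p ^ k"
begin

lemma CHAR_eq: "CHAR('a) = p"
  using CHAR_eq_if_card_prime_power prime card_eq .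

lemma k_pos: "k > 0"
  using card_eq card_field_gt_1[where 'a = 'a] by (auto intro: Nat.gr0I)

lemma p_gt_3: "p > 3"
proof -
  have "p \<noteq> 2" "p \<noteq> 3"
    using p_cong by (auto simp: cong_def)
  then show ?thesis
    using prime_ge_2_nat[OF prime] by linarith
qed

lemma odd_p: "odd p"
  using p_gt_3 prime prime_odd_nat by simp

lemma norm_rep_jacobi: "norm_rep p (p ^ k) jacobi_c jacobi_d"
proof -
  have "(of_int jacobi_c :: 'a) \<noteq> 0"
    using of_nat_central_binomial_neq_0[where 'a = 'a, of k m] prime p_cong card_eq card_field
    by (simp add: of_int_jacobi_c CHAR_eq)
  then have "coprime (int p) jacobi_c"
    using prime by (intro prime_imp_coprime) (simp_all add: of_int_eq_0_iff_char_dvd CHAR_eq)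
  then show ?thesis
    using norm_equation jacobi_c_cong card_eq by (simp add: norm_rep_def coprime_commute)
qed

lemma sign_cong_jacobi:
  assumes "A ^ m = w"
  shows "sign_cong p (p ^ k) A jacobi_c jacobi_d"
proof -
  have "coprime jacobi_c (int p)"
    using norm_rep_jacobi by (simp add: norm_rep_def)
  moreover have "(p ^ k - 1) div 3 = m"
    using card_field card_eq by simp
  ultimately show ?thesis
    using of_int_nine_jacobi_d assms by (simp only: sign_cong_iff[OF CHAR_eq odd_p])
qed

lemma norm_rep_imp_eq_jacobi_c: "norm_rep p (p ^ k) c d \<Longrightarrow> c = jacobi_c"
  using norm_rep_unique(1)[OF prime odd_p k_pos norm_rep_jacobi] .

lemma norm_rep_sign_cong_iff:
  assumes "A ^ m = w"
  shows "norm_rep p (p ^ k) c d \<and> sign_cong p (p ^ k) A c d \<longleftrightarrow> c = jacobi_c \<and> d = jacobi_d"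
  using norm_rep_sign_cong_unique[OF CHAR_eq prime p_gt_3 k_pos norm_rep_jacobi _ sign_cong_jacobi]
    norm_rep_jacobi sign_cong_jacobi assms by blast

end

lemma cubic_residue_power:
  fixes x :: "'a::{field,finite}"
  assumes "CARD('a) = 3 * m + 1" "x \<noteq> 0" "x ^ m \<noteq> 1"
  shows "cubic_residue (x ^ m) m"
proof
  have "(x ^ m) ^ 3 = 1"
    using power_card_minus_1_eq_1[OF assms(2)] assms(1) by (simp add: mult.commute flip: power_mult)
  moreover have "y ^ 3 - 1 = (y - 1) * (y\<^sup>2 + y + 1)" for y :: 'a
    by (simp add: algebra_simps power2_eq_square power3_eq_cube)
  ultimately show "(x ^ m)\<^sup>2 + x ^ m + 1 = 0"
    using assms(3) by (metis mult_eq_0_iff right_minus_eq)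
qed (rule assms(1))

lemma ex_cubic_residue:
  assumes "CARD('a::{field,finite}) = 3 * m + 1"
  shows "\<exists>w::'a. cubic_residue w m"
proof -
  obtain z :: 'a where "z \<noteq> 0" "z ^ m \<noteq> 1"
    using ex_power_neq_1_if_card_eq[OF assms] by auto
  then show ?thesis
    using cubic_residue_power[OF assms] by blast
qed

lemma is_cubic_iff_power_eq_1:
  fixes u :: "'a::{field,finite}"
  assumes "CARD('a) = 3 * m + 1" "u \<noteq> 0"
  shows "is_cubic u \<longleftrightarrow> u ^ m = 1"
  using power_eq_1_iff_nth_power[OF assms] \<open>u \<noteq> 0\<close> by (auto simp: is_cubic_def)

theorem theorem1p9:
  fixes p k q :: nat and a1 a2 a3 :: "'a::{field,finite}"
  assumes "prime p" and "[p = 1] (mod 3)" and "q = p ^ k" and "CARD('a) = q"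
    and "a1 \<noteq> 0" and "a2 \<noteq> 0" and "a3 \<noteq> 0"
  shows "(is_cubic (a1 * a2 * a3) \<longrightarrow>
           (\<exists>!c. \<exists>d. norm_rep p q c d) \<and>
           (\<forall>c d. norm_rep p q c d \<longrightarrow>
              real (card (cubic_zeros a1 a2 a3)) = real q ^ 2 + real_of_int c * (real q - 1)))
       \<and> (\<not> is_cubic (a1 * a2 * a3) \<longrightarrow>
           (\<exists>!(c, d). norm_rep p q c d \<and> sign_cong p q (a1 * a2 * a3) c d) \<and>
           (\<forall>c d. norm_rep p q c d \<and> sign_cong p q (a1 * a2 * a3) c d \<longrightarrow>
              real (card (cubic_zeros a1 a2 a3)) =
                real q ^ 2 + 1 / 2 * (real q - 1) * (9 * real_of_int d - real_of_int c)))"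
proof -
  define A where "A = a1 * a2 * a3"
  have "A \<noteq> 0"
    using assms(5-7) by (simp add: A_def)
  obtain m where card: "CARD('a) = 3 * m + 1"
    using ex_power_eq_mult_3_plus_1[OF assms(2), of k] assms(3,4) by auto
  have prime_power: "cubic_residue_prime_power w m p k" if "cubic_residue w m" for w :: 'a
    using that assms(1-4) by (simp add: cubic_residue_prime_power_def cubic_residue_prime_power_axioms_def)
  show ?thesis
  proof (cases "A ^ m = 1")
    case True
    obtain w :: 'a where "cubic_residue w m"
      using ex_cubic_residue[OF card] ..
    then interpret cubic_residue_prime_power w m p k
      by (rule prime_power)
    show ?thesis
      using True is_cubic_iff_power_eq_1[OF card \<open>A \<noteq> 0\<close>] norm_rep_jacobi norm_rep_imp_eq_jacobi_c
        card_cubic_zeros_if_power_eq_1[OF assms(5-7)] unfolding assms(3,4) A_def by blast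
  next
    case False
    interpret cubic_residue_prime_power "A ^ m" m p k
      using cubic_residue_power[OF card \<open>A \<noteq> 0\<close> False] by (rule prime_power)
    show ?thesis
      using False is_cubic_iff_power_eq_1[OF card \<open>A \<noteq> 0\<close>] norm_rep_sign_cong_iff[of A]
        card_cubic_zeros_if_power_eq_w[OF assms(5-7)] unfolding assms(3,4) A_def by auto
  qed
qed

end
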